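(* Let $X_1,\dots,X_n$ be an i.i.d. sample of size $n$ from the maximal distribution $M_{[\underline{\mu},\overline{\mu}]}$ on a sublinear expectation space $(\Omega,\mathcal{H},\hat{\mathbb{E}})$, with unknown parameters $\underline{\mu}\le\overline{\mu}$. (1) Quasi surely (i.e. $P_\theta$-almost surely for every $\theta\in\Theta$, where $\{P_\theta\}_{\theta\in\Theta}$ is a class of probability measures on $(\Omega,\sigma(\mathcal{H}))$ representing $\hat{\mathbb{E}}$, that is, $\hat{\mathbb{E}}[X]=\max_{\theta\in\Theta}\int_\Omega X\,dP_\theta$ for every $X\in\mathcal{H}$), $$\underline{\mu}\le\min\{X_1(\omega),\dots,X_n(\omega)\}\le\max\{X_1(\omega),\dots,X_n(\omega)\}\le\overline{\mu}.$$ (2) The statistic $\widehat{\overline{\mu}}_n=\max\{X_1,\dots,X_n\}$ is the largest unbiased estimator for the upper mean $\overline{\mu}$. That is, it is an unbiased estimator for $\overline{\mu}$, and every unbiased estimator $f_n(X_1,\dots,X_n)$ for $\overline{\mu}$, $f_n\in C(\mathbb{R}^n)$, satisfies $f_n(y_1,\dots,y_n)\le\max\{y_1,\dots,y_n\}$ for all $(y_1,\dots,y_n)\in\mathbb{R}^n$. (3) The statistic $\widehat{\underline{\mu}}_n=\min\{X_1,\dots,X_n\}$ is the smallest unbiased estimator for the lower mean $\underline{\mu}$. That is, it is an unbiased estimator for $\underline{\mu}$, and every unbiased estimator $f_n(X_1,\dots,X_n)$ for $\underline{\mu}$, $f_n\in C(\mathbb{R}^n)$, satisfies $f_n(y_1,\dots,y_n)\ge\min\{y_1,\dots,y_n\}$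 for all $(y_1,\dots,y_n)\in\mathbb{R}^n$.
   Context: Function spaces: $C(\mathbb{R}^m)$ is the space of continuous real functions on $\mathbb{R}^m$; $C_{Lip}(\mathbb{R}^m)$ is the space of (globally) Lipschitz real functions on $\mathbb{R}^m$; $C_{l.Lip}(\mathbb{R}^m)$ is the space of functions $\varphi$ with $|\varphi(x)-\varphi(y)|\le C(1+|x|^k+|y|^k)|x-y|$ for all $x,y\in\mathbb{R}^m$, for some $C>0$ and $k\in\mathbb{N}$ depending on $\varphi$. Sublinear expectation space: a triple $(\Omega,\mathcal{H},\hat{\mathbb{E}})$ where $\Omega$ is a set and $\mathcal{H}$ is a linear space of real-valued functions on $\Omega$ that contains all constants, is closed under $X\mapsto|X|$, and satisfies $\varphi(X_1,\dots,X_m)\in\mathcal{H}$ whenever $X_1,\dots,X_m\in\mathcal{H}$ and $\varphi\in C_{Lip}(\mathbb{R}^m)$. The functional $\hat{\mathbb{E}}:\mathcal{H}\to\mathbb{R}$ satisfies: (i) $\hat{\mathbb{E}}[X]\ge\hat{\mathbb{E}}[Y]$ if $X\ge Y$; (ii) $\hat{\mathbb{E}}[c]=c$ for $c\in\mathbb{R}$; (iii) $\hat{\mathbb{E}}[X+Y]\le\hat{\mathbb{E}}[X]+\hat{\mathbb{E}}[Y]$; (iv) $\hat{\mathbb{E}}[\lambda X]=\lambda\hat{\mathbb{E}}[X]$ for $\lambda\ge0$. $\sigma(\mathcal{H})$ is the smallest $\sigma$-algebra generated by $\mathcal{H}$. Maximal distribution: $\eta\in\mathcal{H}$ has maximal distribution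 $M_{[\underline{\mu},\overline{\mu}]}$, written $\eta\overset{d}{=}M_{[\underline{\mu},\overline{\mu}]}$, if $\hat{\mathbb{E}}[\varphi(\eta)]=\max_{\underline{\mu}\le y\le\overline{\mu}}\varphi(y)$ for all $\varphi\in C_{l.Lip}(\mathbb{R})$. Then $\overline{\mu}=\hat{\mathbb{E}}[\eta]$ is the upper mean and $\underline{\mu}=-\hat{\mathbb{E}}[-\eta]$ is the lower mean. Independence: $Y\in\mathcal{H}^k$ is independent of $X\in\mathcal{H}^m$ if $\hat{\mathbb{E}}[\varphi(X,Y)]=\hat{\mathbb{E}}\big[\hat{\mathbb{E}}[\varphi(x,Y)]_{x=X}\big]$ for all $\varphi\in C_{Lip}(\mathbb{R}^{m+k})$. This relation is not symmetric in general. I.i.d. sample from $M_{[\underline{\mu},\overline{\mu}]}$: $X_1,\dots,X_n\in\mathcal{H}$ with $X_i\overset{d}{=}M_{[\underline{\mu},\overline{\mu}]}$ for each $i$ and $X_i$ independent of $(X_1,\dots,X_{i-1})$ for $i=2,\dots,n$. Unbiased estimator: for $f_n\in C(\mathbb{R}^n)$, the statistic $f_n(X_1,\dots,X_n)$ is called an unbiased estimator for the upper mean $\overline{\mu}$ (resp. for the lower mean $\underline{\mu}$) if $\hat{\mathbb{E}}[f_n(X_1,\dots,X_n)]=\overline{\mu}$ (resp. $-\hat{\mathbb{E}}[-f_n(X_1,\dots,X_n)]=\underline{\mu}$) for all $-\infty<\underline{\mu}\le\overline{\mu}<\infty$. Here $f_n$ is fixed while the parameters vary: the equality is required for all such parameters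 and every i.i.d. sample $X_1,\dots,X_n$ from $M_{[\underline{\mu},\overline{\mu}]}$ on a sublinear expectation space for which $f_n(X_1,\dots,X_n)\in\mathcal{H}$, i.e. for which the expectation is defined. *)

theory Defs
  imports "HOL-Probability.Probability"
begin

text \<open>Points of $R^m$ are the elements of \<open>topspace (Euclidean_space m)\<close>, i.e. the functions
  \<open>x :: nat \<Rightarrow> real\<close> with \<open>x i = 0\<close> for \<open>i \<ge> m\<close>; coordinates are numbered \<open>0, \<dots>, m - 1\<close>.
  Functions on $R^m$ are HOL functions whose values off this set are irrelevant.\<close>

definition tuple :: "nat \<Rightarrow> (nat \<Rightarrow> 'a \<Rightarrow> real) \<Rightarrow> 'a \<Rightarrow> nat \<Rightarrow> real"
  where "tuple m X \<omega> = (\<lambda>i. if i < m then X i \<omega> else 0)"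

definition append_point :: "nat \<Rightarrow> (nat \<Rightarrow> real) \<Rightarrow> (nat \<Rightarrow> real) \<Rightarrow> nat \<Rightarrow> real"
  where "append_point m x y = (\<lambda>i. if i < m then x i else y (i - m))"

definition C_cont :: "nat \<Rightarrow> ((nat \<Rightarrow> real) \<Rightarrow> real) set"
  where "C_cont m = {\<phi>. continuous_map (Euclidean_space m) euclideanreal \<phi>}"

definition C_Lip :: "nat \<Rightarrow> ((nat \<Rightarrow> real) \<Rightarrow> real) set"
  where "C_Lip m = {\<phi>. \<exists>C. \<forall>x \<in> topspace (Euclidean_space m). \<forall>y \<in> topspace (Euclidean_space m).
    \<bar>\<phi> x - \<phi> y\<bar> \<le> C * L2_set (\<lambda>i. x i - y i) {..<m}}"

text \<open>Only the one-dimensional instance of the next space is used, so it is stated for functions on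
  a normed space and applied with \<open>'v = real\<close>.\<close>

definition C_lLip :: "('v::real_normed_vector \<Rightarrow> real) set"
  where "C_lLip = {\<phi>. \<exists>C>0. \<exists>k::nat. \<forall>x y.
    \<bar>\<phi> x - \<phi> y\<bar> \<le> C * (1 + norm x ^ k + norm y ^ k) * norm (x - y)}"

definition is_maximum :: "real set \<Rightarrow> real \<Rightarrow> bool"
  where "is_maximum A m \<longleftrightarrow> m \<in> A \<and> (\<forall>a\<in>A. a \<le> m)"

text \<open>A set \<open>\<H>\<close> of real functions on the carrier \<open>\<Omega> :: 'a set\<close> is represented by the set of all
  functions on \<open>'a\<close> whose restriction to \<open>\<Omega>\<close> belongs to it (axiom \<open>carrier_cong\<close>). The values of the
  functional outside \<open>\<H>\<close> are irrelevant.\<close>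

locale sublinear_expectation_space =
  fixes \<Omega> :: "'a set" and \<H> :: "('a \<Rightarrow> real) set" and \<E> :: "('a \<Rightarrow> real) \<Rightarrow> real"
  assumes carrier_cong: "X \<in> \<H> \<Longrightarrow> (\<And>\<omega>. \<omega> \<in> \<Omega> \<Longrightarrow> Y \<omega> = X \<omega>) \<Longrightarrow> Y \<in> \<H>"
    and add_closed: "X \<in> \<H> \<Longrightarrow> Y \<in> \<H> \<Longrightarrow> (\<lambda>\<omega>. X \<omega> + Y \<omega>) \<in> \<H>"
    and scale_closed: "X \<in> \<H> \<Longrightarrow> (\<lambda>\<omega>. c * X \<omega>) \<in> \<H>"
    and const_closed: "(\<lambda>\<omega>. c) \<in> \<H>"
    and abs_closed: "X \<in> \<H> \<Longrightarrow> (\<lambda>\<omega>. \<bar>X \<omega>\<bar>) \<in> \<H>"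
    and Lip_closed: "(\<And>i. i < m \<Longrightarrow> Z i \<in> \<H>) \<Longrightarrow> \<phi> \<in> C_Lip m \<Longrightarrow> (\<lambda>\<omega>. \<phi> (tuple m Z \<omega>)) \<in> \<H>"
    and mono: "X \<in> \<H> \<Longrightarrow> Y \<in> \<H> \<Longrightarrow> (\<And>\<omega>. \<omega> \<in> \<Omega> \<Longrightarrow> Y \<omega> \<le> X \<omega>) \<Longrightarrow> \<E> Y \<le> \<E> X"
    and const: "\<E> (\<lambda>\<omega>. c) = c"
    and subadd: "X \<in> \<H> \<Longrightarrow> Y \<in> \<H> \<Longrightarrow> \<E> (\<lambda>\<omega>. X \<omega> + Y \<omega>) \<le> \<E> X + \<E> Y"
    and pos_hom: "X \<in> \<H> \<Longrightarrow> 0 \<le> l \<Longrightarrow> \<E> (\<lambda>\<omega>. l * X \<omega>) = l * \<E> X"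

text \<open>The smallest sigma-algebra on \<open>\<Omega>\<close> making every element of \<open>\<H>\<close> measurable.\<close>

definition generated_sigma :: "'a set \<Rightarrow> ('a \<Rightarrow> real) set \<Rightarrow> 'a set set"
  where "generated_sigma \<Omega> \<H> = sigma_sets \<Omega> {X -` B \<inter> \<Omega> | X B. X \<in> \<H> \<and> B \<in> sets borel}"

text \<open>Integrability is demanded because the Bochner integral of a non-integrable function is \<open>0\<close>
  by convention.\<close>

definition represents ::
    "'a set \<Rightarrow> ('a \<Rightarrow> real) set \<Rightarrow> (('a \<Rightarrow> real) \<Rightarrow> real) \<Rightarrow> 't set \<Rightarrow> ('t \<Rightarrow> 'a measure) \<Rightarrow> bool"
  where "represents \<Omega> \<H> \<E> \<Theta> P \<longleftrightarrow>
    (\<forall>\<theta>\<in>\<Theta>. prob_space (P \<theta>) \<and> space (P \<theta>) = \<Omega> \<and> sets (P \<theta>) = generated_sigma \<Omega> \<H>) \<and>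
    (\<forall>X\<in>\<H>. (\<forall>\<theta>\<in>\<Theta>. integrable (P \<theta>) X) \<and>
      is_maximum ((\<lambda>\<theta>. \<integral>\<omega>. X \<omega> \<partial>P \<theta>) ` \<Theta>) (\<E> X))"

definition quasi_surely :: "'t set \<Rightarrow> ('t \<Rightarrow> 'a measure) \<Rightarrow> ('a \<Rightarrow> bool) \<Rightarrow> bool"
  where "quasi_surely \<Theta> P Q \<longleftrightarrow> (\<forall>\<theta>\<in>\<Theta>. AE \<omega> in P \<theta>. Q \<omega>)"

text \<open>For the left-hand side of the defining identity to be meaningful, \<open>\<phi>(\<eta>)\<close> has to belong to the
  domain \<open>\<H>\<close> of the functional.\<close>

definition maximal_distribution ::
    "('a \<Rightarrow> real) set \<Rightarrow> (('a \<Rightarrow> real) \<Rightarrow> real) \<Rightarrow> real \<Rightarrow> real \<Rightarrow> ('a \<Rightarrow> real) \<Rightarrow> bool"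
  where "maximal_distribution \<H> \<E> lo hi \<eta> \<longleftrightarrow>
    \<eta> \<in> \<H> \<and>
    (\<forall>\<phi>\<in>C_lLip. (\<lambda>\<omega>. \<phi> (\<eta> \<omega>)) \<in> \<H> \<and> is_maximum (\<phi> ` {lo..hi}) (\<E> (\<lambda>\<omega>. \<phi> (\<eta> \<omega>))))"

text \<open>\<open>independent_of \<H> \<E> k Y m X\<close>: the vector \<open>(Y\<^sub>0, \<dots>, Y\<^sub>k\<^sub>-\<^sub>1)\<close> is independent of
  \<open>(X\<^sub>0, \<dots>, X\<^sub>m\<^sub>-\<^sub>1)\<close>. The order of the arguments matters.\<close>

definition independent_of ::
    "('a \<Rightarrow> real) set \<Rightarrow> (('a \<Rightarrow> real) \<Rightarrow> real) \<Rightarrow> nat \<Rightarrow> (nat \<Rightarrow> 'a \<Rightarrow> real) \<Rightarrow>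
      nat \<Rightarrow> (nat \<Rightarrow> 'a \<Rightarrow> real) \<Rightarrow> bool"
  where "independent_of \<H> \<E> k Y m X \<longleftrightarrow>
    (\<forall>j<k. Y j \<in> \<H>) \<and> (\<forall>i<m. X i \<in> \<H>) \<and>
    (\<forall>\<phi>\<in>C_Lip (m + k).
      \<E> (\<lambda>\<omega>. \<phi> (append_point m (tuple m X \<omega>) (tuple k Y \<omega>))) =
      \<E> (\<lambda>\<omega>. \<E> (\<lambda>\<omega>'. \<phi> (append_point m (tuple m X \<omega>) (tuple k Y \<omega>')))))"

text \<open>The sample is \<open>X\<^sub>0, \<dots>, X\<^sub>n\<^sub>-\<^sub>1\<close>.\<close>

definition iid_maximal_sample ::
    "('a \<Rightarrow> real) set \<Rightarrow> (('a \<Rightarrow> real) \<Rightarrow> real) \<Rightarrow> real \<Rightarrow> real \<Rightarrow> nat \<Rightarrow> (nat \<Rightarrow> 'a \<Rightarrow> real) \<Rightarrow> bool"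
  where "iid_maximal_sample \<H> \<E> lo hi n X \<longleftrightarrow>
    (\<forall>i<n. maximal_distribution \<H> \<E> lo hi (X i)) \<and>
    (\<forall>i\<in>{1..<n}. independent_of \<H> \<E> 1 (\<lambda>_. X i) i X)"

text \<open>HOL formulas cannot quantify over all types, so unbiasedness is relative to the type \<open>'a\<close> that
  contains the sample spaces. Lemmas \<open>unbiased_upper_mean_transfer\<close> and
  \<open>unbiased_lower_mean_transfer\<close> below show that \<open>'a = nat \<Rightarrow> real\<close> is universal: unbiasedness over
  sample spaces of that type is unbiasedness over sample spaces of every type.\<close>

definition unbiased_upper_mean :: "'a itself \<Rightarrow> nat \<Rightarrow> ((nat \<Rightarrow> real) \<Rightarrow> real) \<Rightarrow> bool"
  where "unbiased_upper_mean (_ :: 'a itself) n f \<longleftrightarrow>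
    f \<in> C_cont n \<and>
    (\<forall>lo hi. lo \<le> hi \<longrightarrow>
      (\<forall>(\<Omega> :: 'a set) \<H> \<E> X.
        sublinear_expectation_space \<Omega> \<H> \<E> \<longrightarrow> iid_maximal_sample \<H> \<E> lo hi n X \<longrightarrow>
        (\<lambda>\<omega>. f (tuple n X \<omega>)) \<in> \<H> \<longrightarrow>
        \<E> (\<lambda>\<omega>. f (tuple n X \<omega>)) = hi))"

definition unbiased_lower_mean :: "'a itself \<Rightarrow> nat \<Rightarrow> ((nat \<Rightarrow> real) \<Rightarrow> real) \<Rightarrow> bool"
  where "unbiased_lower_mean (_ :: 'a itself) n f \<longleftrightarrow>
    f \<in> C_cont n \<and>
    (\<forall>lo hi. lo \<le> hi \<longrightarrow>
      (\<forall>(\<Omega> :: 'a set) \<H> \<E> X.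
        sublinear_expectation_space \<Omega> \<H> \<E> \<longrightarrow> iid_maximal_sample \<H> \<E> lo hi n X \<longrightarrow>
        (\<lambda>\<omega>. f (tuple n X \<omega>)) \<in> \<H> \<longrightarrow>
        - \<E> (\<lambda>\<omega>. - f (tuple n X \<omega>)) = lo))"

definition max_stat :: "nat \<Rightarrow> (nat \<Rightarrow> real) \<Rightarrow> real"
  where "max_stat n y = Max (y ` {..<n})"

definition min_stat :: "nat \<Rightarrow> (nat \<Rightarrow> real) \<Rightarrow> real"
  where "min_stat n y = Min (y ` {..<n})"

text \<open>Every sample space with a sample can be pushed forward along the sample to $R^n$.\<close>

lemma tuple_coords: "i \<le> n \<Longrightarrow> tuple i (\<lambda>j x. x j) (tuple n X \<omega>) = tuple i X \<omega>"
  by (auto simp: tuple_def)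

lemma tuple_topspace: "tuple n X \<omega> \<in> topspace (Euclidean_space n)"
  by (simp add: tuple_def topspace_Euclidean_space)

lemma pushforward_space:
  assumes "sublinear_expectation_space \<Omega> \<H> \<E>"
  shows "sublinear_expectation_space (topspace (Euclidean_space n))
           {Y. (\<lambda>\<omega>. Y (tuple n X \<omega>)) \<in> \<H>} (\<lambda>Y. \<E> (\<lambda>\<omega>. Y (tuple n X \<omega>)))"
proof -
  interpret sublinear_expectation_space \<Omega> \<H> \<E> by fact
  show ?thesis
  proof
    fix Y Z :: "(nat \<Rightarrow> real) \<Rightarrow> real"
    assume "Y \<in> {Y. (\<lambda>\<omega>. Y (tuple n X \<omega>)) \<in> \<H>}"
      and "\<And>x. x \<in> topspace (Euclidean_space n) \<Longrightarrow> Z x = Y x"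
    then show "Z \<in> {Y. (\<lambda>\<omega>. Y (tuple n X \<omega>)) \<in> \<H>}"
      by (simp add: tuple_topspace)
  next
    fix m and Z :: "nat \<Rightarrow> (nat \<Rightarrow> real) \<Rightarrow> real" and \<phi>
    assume Z: "\<And>i. i < m \<Longrightarrow> Z i \<in> {Y. (\<lambda>\<omega>. Y (tuple n X \<omega>)) \<in> \<H>}" and "\<phi> \<in> C_Lip m"
    then have "(\<lambda>\<omega>. \<phi> (tuple m (\<lambda>i \<omega>. Z i (tuple n X \<omega>)) \<omega>)) \<in> \<H>"
      by (intro Lip_closed[where Z = "\<lambda>i \<omega>. Z i (tuple n X \<omega>)"]) simp_all
    then show "(\<lambda>x. \<phi> (tuple m Z x)) \<in> {Y. (\<lambda>\<omega>. Y (tuple n X \<omega>)) \<in> \<H>}"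
      by (simp add: tuple_def)
  qed (auto intro: add_closed scale_closed const_closed abs_closed mono subadd
      simp: const pos_hom tuple_topspace)
qed

lemma pushforward_sample:
  assumes "iid_maximal_sample \<H> \<E> lo hi n X"
  shows "iid_maximal_sample {Y. (\<lambda>\<omega>. Y (tuple n X \<omega>)) \<in> \<H>}
           (\<lambda>Y. \<E> (\<lambda>\<omega>. Y (tuple n X \<omega>))) lo hi n (\<lambda>i x. x i)"
proof -
  have coord: "tuple n X \<omega> i = X i \<omega>" if "i < n" for i \<omega>
    using that by (simp add: tuple_def)
  have single: "tuple (Suc 0) (\<lambda>_ x. x i) (tuple n X \<omega>) = tuple (Suc 0) (\<lambda>_. X i) \<omega>" if "i < n" for i \<omega>
    using that by (auto simp: tuple_def)
  show ?thesis
    using assms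
    unfolding iid_maximal_sample_def maximal_distribution_def independent_of_def
    by (simp add: coord single tuple_coords less_imp_le)
qed

lemma unbiased_upper_mean_transfer:
  assumes "unbiased_upper_mean TYPE(nat \<Rightarrow> real) n f"
  shows "unbiased_upper_mean TYPE('a) n f"
  unfolding unbiased_upper_mean_def
proof (intro conjI allI impI)
  show "f \<in> C_cont n"
    using assms by (simp add: unbiased_upper_mean_def)
next
  fix lo hi and \<Omega> :: "'a set" and \<H> \<E> X
  assume *: "lo \<le> hi" "sublinear_expectation_space \<Omega> \<H> \<E>" "iid_maximal_sample \<H> \<E> lo hi n X"
    and "(\<lambda>\<omega>. f (tuple n X \<omega>)) \<in> \<H>"
  then have "(\<lambda>x. f (tuple n (\<lambda>i x. x i) x)) \<in> {Y. (\<lambda>\<omega>. Y (tuple n X \<omega>)) \<in> \<H>}"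
    by (simp add: tuple_coords)
  from assms[unfolded unbiased_upper_mean_def, THEN conjunct2, rule_format,
      OF *(1) pushforward_space[OF *(2)] pushforward_sample[OF *(3)] this]
  show "\<E> (\<lambda>\<omega>. f (tuple n X \<omega>)) = hi"
    by (simp add: tuple_coords)
qed

lemma unbiased_lower_mean_transfer:
  assumes "unbiased_lower_mean TYPE(nat \<Rightarrow> real) n f"
  shows "unbiased_lower_mean TYPE('a) n f"
  unfolding unbiased_lower_mean_def
proof (intro conjI allI impI)
  show "f \<in> C_cont n"
    using assms by (simp add: unbiased_lower_mean_def)
next
  fix lo hi and \<Omega> :: "'a set" and \<H> \<E> X
  assume *: "lo \<le> hi" "sublinear_expectation_space \<Omega> \<H> \<E>" "iid_maximal_sample \<H> \<E> lo hi n X"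
    and "(\<lambda>\<omega>. f (tuple n X \<omega>)) \<in> \<H>"
  then have "(\<lambda>x. f (tuple n (\<lambda>i x. x i) x)) \<in> {Y. (\<lambda>\<omega>. Y (tuple n X \<omega>)) \<in> \<H>}"
    by (simp add: tuple_coords)
  from assms[unfolded unbiased_lower_mean_def, THEN conjunct2, rule_format,
      OF *(1) pushforward_space[OF *(2)] pushforward_sample[OF *(3)] this]
  show "- \<E> (\<lambda>\<omega>. - f (tuple n X \<omega>)) = lo"
    by (simp add: tuple_coords)
qed

end

theory Submission
  imports Defs
begin

text \<open>The distance \<open>d\<close> to the interval \<open>{lo..hi}\<close> is \<open>1\<close>-Lipschitz and vanishes on that interval, so
  \<open>\<E> d(X\<^sub>i) = 0\<close> for every maximally distributed \<open>X\<^sub>i\<close>. This one identity controls the sample from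
  outside the interval.

  If \<open>\<E>\<close> is represented by probability measures, \<open>d(X\<^sub>i)\<close> is a nonnegative function whose integral
  under each of them is at most \<open>0\<close>. Hence it vanishes almost surely, which places \<open>X\<^sub>i\<close> in the
  interval quasi surely (\<open>maximal_distribution_quasi_surely\<close>).

  For unbiasedness, \<open>X\<^sub>i \<le> hi + d(X\<^sub>i)\<close> gives \<open>max X\<^sub>i \<le> hi + \<Sum>\<^sub>i d(X\<^sub>i)\<close>, and subadditivity of \<open>\<E>\<close> turns
  this into \<open>\<E>[max X\<^sub>i] \<le> hi\<close>; the reverse inequality is monotonicity applied to the first
  observation, whose upper mean is \<open>hi\<close> (\<open>expectation_max_sample\<close>). The minimum is treated
  symmetrically.

  For extremality, fix a point \<open>y\<close> of $R^n$ and let \<open>lo\<close>, \<open>hi\<close> be its smallest and largest coordinate,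
  so that \<open>y\<close> lies in the cube \<open>{lo..hi}\<^sup>n\<close>. On the cube the supremum is a sublinear expectation on
  the bounded functions, and the coordinates form an i.i.d. sample with parameters \<open>lo\<close>, \<open>hi\<close>
  (\<open>canonical_sample\<close>): the cube is a product set, so its supremum is an iterated one, which
  is independence. An unbiased \<open>f\<close> thus has supremum \<open>hi\<close> over the cube, and in particular
  \<open>f y \<le> hi = max y\<close>. For the lower mean the same argument applies to \<open>- f\<close>.\<close>

section \<open>Maximally distributed variables\<close>

lemma Lipschitz1_in_C_lLip:
  assumes "\<And>x y. \<bar>\<phi> x - \<phi> y\<bar> \<le> norm (x - y)"
  shows "\<phi> \<in> C_lLip"
proof -
  have "\<bar>\<phi> x - \<phi> y\<bar> \<le> 1 * (1 + norm x ^ 0 + norm y ^ 0) * norm (x - y)" for x y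
    using assms[of x y] norm_ge_zero[of "x - y"] by simp
  then show ?thesis
    unfolding C_lLip_def by (intro CollectI exI[of _ 1] exI[of _ 0] conjI) auto
qed

lemma infdist_in_C_lLip: "(\<lambda>x. infdist x A) \<in> C_lLip"
  by (rule Lipschitz1_in_C_lLip) (metis infdist_triangle_abs dist_norm)

text \<open>The nearest point of the interval lies between \<open>lo\<close> and \<open>hi\<close>, so \<open>x\<close> leaves the interval on
  either side by at most its distance.\<close>

lemma infdist_Icc_bounds:
  fixes x :: real
  assumes "lo \<le> hi"
  shows "lo - infdist x {lo..hi} \<le> x" "x \<le> hi + infdist x {lo..hi}"
proof -
  obtain z where "z \<in> {lo..hi}" "infdist x {lo..hi} = dist x z"
    using infdist_attains_inf[of "{lo..hi}" x] assms by auto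
  then show "lo - infdist x {lo..hi} \<le> x" "x \<le> hi + infdist x {lo..hi}"
    by (auto simp: dist_real_def)
qed

lemma maximal_distribution_infdist:
  assumes "maximal_distribution \<H> \<E> lo hi \<eta>"
  shows "(\<lambda>\<omega>. infdist (\<eta> \<omega>) {lo..hi}) \<in> \<H>" "\<E> (\<lambda>\<omega>. infdist (\<eta> \<omega>) {lo..hi}) = 0"
  using assms infdist_in_C_lLip[of "{lo..hi}"]
  unfolding maximal_distribution_def is_maximum_def by fastforce+

lemma maximal_distribution_means:
  assumes "maximal_distribution \<H> \<E> lo hi \<eta>" "lo \<le> hi"
  shows "\<E> \<eta> = hi" "\<E> (\<lambda>\<omega>. - \<eta> \<omega>) = - lo"
proof -
  have id: "(\<lambda>x::real. x) \<in> C_lLip" and neg: "(\<lambda>x::real. - x) \<in> C_lLip"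
    by (auto intro!: Lipschitz1_in_C_lLip)
  have "is_maximum ((\<lambda>x. x) ` {lo..hi}) (\<E> \<eta>)"
    using assms(1) id unfolding maximal_distribution_def by fastforce
  with assms(2) show "\<E> \<eta> = hi"
    unfolding is_maximum_def by force
  have "is_maximum (uminus ` {lo..hi}) (\<E> (\<lambda>\<omega>. - \<eta> \<omega>))"
    using assms(1) neg unfolding maximal_distribution_def by fastforce
  then have "\<E> (\<lambda>\<omega>. - \<eta> \<omega>) \<in> {- hi..- lo}" "\<forall>a\<in>{- hi..- lo}. a \<le> \<E> (\<lambda>\<omega>. - \<eta> \<omega>)"
    unfolding is_maximum_def by simp_all
  with assms(2) show "\<E> (\<lambda>\<omega>. - \<eta> \<omega>) = - lo"
    by (intro antisym) auto
qed

text \<open>A nonnegative function with vanishing upper expectation has integral \<open>0\<close> under every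
  representing measure, hence is null; this is applied to the distance from the interval.\<close>

lemma maximal_distribution_quasi_surely:
  assumes "maximal_distribution \<H> \<E> lo hi \<eta>" "lo \<le> hi" "represents \<Omega> \<H> \<E> \<Theta> P"
  shows "quasi_surely \<Theta> P (\<lambda>\<omega>. lo \<le> \<eta> \<omega> \<and> \<eta> \<omega> \<le> hi)"
  unfolding quasi_surely_def
proof
  fix \<theta> assume \<theta>: "\<theta> \<in> \<Theta>"
  let ?D = "\<lambda>\<omega>. infdist (\<eta> \<omega>) {lo..hi}"
  have int: "integrable (P \<theta>) ?D" and le: "(\<integral>\<omega>. ?D \<omega> \<partial>P \<theta>) \<le> 0"
    using assms(3) \<theta> maximal_distribution_infdist[OF assms(1)]
    unfolding represents_def is_maximum_def by force+
  then have "(\<integral>\<omega>. ?D \<omega> \<partial>P \<theta>) = 0"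
    by (simp add: antisym infdist_nonneg)
  then have "AE \<omega> in P \<theta>. ?D \<omega> = 0"
    using int by (subst (asm) integral_nonneg_eq_0_iff_AE) (auto simp: infdist_nonneg)
  then show "AE \<omega> in P \<theta>. lo \<le> \<eta> \<omega> \<and> \<eta> \<omega> \<le> hi"
  proof eventually_elim
    case (elim \<omega>)
    then show ?case using infdist_Icc_bounds[OF assms(2), of "\<eta> \<omega>"] by simp
  qed
qed

section \<open>Upper and lower means of the extreme order statistics\<close>

lemma max_stat_tuple: "max_stat n (tuple n X \<omega>) = Max ((\<lambda>i. X i \<omega>) ` {..<n})"
  unfolding max_stat_def by (rule arg_cong[where f = Max]) (auto simp: tuple_def image_iff)

lemma min_stat_tuple: "min_stat n (tuple n X \<omega>) = Min ((\<lambda>i. X i \<omega>) ` {..<n})"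
  unfolding min_stat_def by (rule arg_cong[where f = Min]) (auto simp: tuple_def image_iff)

lemma min_stat_le_max_stat: "1 \<le> n \<Longrightarrow> min_stat n y \<le> max_stat n y"
  unfolding min_stat_def max_stat_def
  by (rule order_trans[of _ "y 0"]) auto

context sublinear_expectation_space
begin

lemma expectation_le_const_plus_sum:
  fixes n :: nat
  assumes "Y \<in> \<H>" "\<And>i. i < n \<Longrightarrow> D i \<in> \<H>"
    and "\<And>\<omega>. \<omega> \<in> \<Omega> \<Longrightarrow> Y \<omega> \<le> c + (\<Sum>i<n. D i \<omega>)"
  shows "\<E> Y \<le> c + (\<Sum>i<n. \<E> (D i))"
proof -
  have "(\<lambda>\<omega>. c + (\<Sum>i<n. D i \<omega>)) \<in> \<H> \<and> \<E> (\<lambda>\<omega>. c + (\<Sum>i<n. D i \<omega>)) \<le> c + (\<Sum>i<n. \<E> (D i))"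
    using assms(2)
  proof (induction n)
    case 0
    then show ?case by (simp add: const const_closed)
  next
    case (Suc n)
    let ?S = "\<lambda>\<omega>. c + (\<Sum>i<n. D i \<omega>)"
    have S: "?S \<in> \<H>" "\<E> ?S \<le> c + (\<Sum>i<n. \<E> (D i))" and D: "D n \<in> \<H>"
      using Suc by auto
    have "(\<lambda>\<omega>. ?S \<omega> + D n \<omega>) \<in> \<H>" "\<E> (\<lambda>\<omega>. ?S \<omega> + D n \<omega>) \<le> \<E> ?S + \<E> (D n)"
      using S D by (auto intro: add_closed subadd)
    with S show ?case by (simp add: add.assoc)
  qed
  then have sum: "(\<lambda>\<omega>. c + (\<Sum>i<n. D i \<omega>)) \<in> \<H>"
    "\<E> (\<lambda>\<omega>. c + (\<Sum>i<n. D i \<omega>)) \<le> c + (\<Sum>i<n. \<E> (D i))"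
    by simp_all
  show ?thesis
    using mono[OF sum(1) assms(1) assms(3)] sum(2) by linarith
qed

text \<open>The maximum exceeds \<open>hi\<close> by at most the sum of the distances of the observations from the
  interval, whose expectation is \<open>0\<close>; it dominates the first observation, whose expectation is
  already \<open>hi\<close>.\<close>

lemma expectation_max_sample:
  assumes "1 \<le> n" "lo \<le> hi" "\<And>i. i < n \<Longrightarrow> maximal_distribution \<H> \<E> lo hi (X i)"
    and H: "(\<lambda>\<omega>. max_stat n (tuple n X \<omega>)) \<in> \<H>"
  shows "\<E> (\<lambda>\<omega>. max_stat n (tuple n X \<omega>)) = hi"
proof (rule antisym)
  let ?D = "\<lambda>i \<omega>. infdist (X i \<omega>) {lo..hi}"
  have "max_stat n (tuple n X \<omega>) \<le> hi + (\<Sum>i<n. ?D i \<omega>)" for \<omega>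
  proof -
    have "X i \<omega> \<le> hi + (\<Sum>i<n. ?D i \<omega>)" if "i < n" for i
      using infdist_Icc_bounds(2)[OF assms(2), of "X i \<omega>"] that
        member_le_sum[of i "{..<n}" "\<lambda>i. ?D i \<omega>"] by (simp add: infdist_nonneg)
    then show ?thesis
      using assms(1) by (auto simp: max_stat_tuple lessThan_empty_iff)
  qed
  then have "\<E> (\<lambda>\<omega>. max_stat n (tuple n X \<omega>)) \<le> hi + (\<Sum>i<n. \<E> (?D i))"
    using maximal_distribution_infdist(1)[OF assms(3)]
    by (intro expectation_le_const_plus_sum H)
  also have "\<dots> = hi"
    using maximal_distribution_infdist(2)[OF assms(3)] by simp
  finally show "\<E> (\<lambda>\<omega>. max_stat n (tuple n X \<omega>)) \<le> hi" .
  have X0: "maximal_distribution \<H> \<E> lo hi (X 0)"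
    using assms(1,3) by simp
  have "\<E> (X 0) \<le> \<E> (\<lambda>\<omega>. max_stat n (tuple n X \<omega>))"
    using X0 assms(1) H by (intro mono) (auto simp: maximal_distribution_def max_stat_tuple)
  then show "hi \<le> \<E> (\<lambda>\<omega>. max_stat n (tuple n X \<omega>))"
    using maximal_distribution_means(1)[OF X0 assms(2)] by simp
qed

lemma expectation_min_sample:
  assumes "1 \<le> n" "lo \<le> hi" "\<And>i. i < n \<Longrightarrow> maximal_distribution \<H> \<E> lo hi (X i)"
    and H: "(\<lambda>\<omega>. min_stat n (tuple n X \<omega>)) \<in> \<H>"
  shows "- \<E> (\<lambda>\<omega>. - min_stat n (tuple n X \<omega>)) = lo"
proof -
  let ?D = "\<lambda>i \<omega>. infdist (X i \<omega>) {lo..hi}"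
  have neg: "(\<lambda>\<omega>. - Y \<omega>) \<in> \<H>" if "Y \<in> \<H>" for Y
    using scale_closed[OF that, of "- 1"] by simp
  have "- min_stat n (tuple n X \<omega>) \<le> - lo + (\<Sum>i<n. ?D i \<omega>)" for \<omega>
  proof -
    have "lo - (\<Sum>i<n. ?D i \<omega>) \<le> X i \<omega>" if "i < n" for i
      using infdist_Icc_bounds(1)[OF assms(2), of "X i \<omega>"] that
        member_le_sum[of i "{..<n}" "\<lambda>i. ?D i \<omega>"] by (simp add: infdist_nonneg)
    then have "lo - (\<Sum>i<n. ?D i \<omega>) \<le> min_stat n (tuple n X \<omega>)"
      using assms(1) by (auto simp: min_stat_tuple lessThan_empty_iff)
    then show ?thesis by simp
  qed
  then have "\<E> (\<lambda>\<omega>. - min_stat n (tuple n X \<omega>)) \<le> - lo + (\<Sum>i<n. \<E> (?D i))"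
    using maximal_distribution_infdist(1)[OF assms(3)]
    by (intro expectation_le_const_plus_sum neg[OF H])
  also have "\<dots> = - lo"
    using maximal_distribution_infdist(2)[OF assms(3)] by simp
  finally have "\<E> (\<lambda>\<omega>. - min_stat n (tuple n X \<omega>)) \<le> - lo" .
  moreover have X0: "maximal_distribution \<H> \<E> lo hi (X 0)"
    using assms(1,3) by simp
  have "\<E> (\<lambda>\<omega>. - X 0 \<omega>) \<le> \<E> (\<lambda>\<omega>. - min_stat n (tuple n X \<omega>))"
    using X0 assms(1) by (intro mono neg H) (auto simp: maximal_distribution_def min_stat_tuple)
  ultimately show ?thesis
    using maximal_distribution_means(2)[OF X0 assms(2)] by simp
qed

end

section \<open>The worst-case expectation on a set\<close>

text \<open>Taking all bounded functions as the domain makes closure under Lipschitz functions a matter of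
  bounds alone, while every continuous statistic on a compact set is still included.\<close>

definition bounded_fun_on :: "'a set \<Rightarrow> ('a \<Rightarrow> real) set"
  where "bounded_fun_on K = {Y. bounded (Y ` K)}"

definition sup_expectation :: "'a set \<Rightarrow> ('a \<Rightarrow> real) \<Rightarrow> real"
  where "sup_expectation K Y = (SUP \<omega>\<in>K. Y \<omega>)"

lemma bounded_fun_onI: "(\<And>\<omega>. \<omega> \<in> K \<Longrightarrow> \<bar>Y \<omega>\<bar> \<le> B) \<Longrightarrow> Y \<in> bounded_fun_on K"
  unfolding bounded_fun_on_def bounded_iff by auto

lemma bounded_fun_onE:
  assumes "Y \<in> bounded_fun_on K"
  obtains B where "\<And>\<omega>. \<omega> \<in> K \<Longrightarrow> \<bar>Y \<omega>\<bar> \<le> B"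
  using assms unfolding bounded_fun_on_def bounded_iff by auto

lemma sup_expectation_upper: "Y \<in> bounded_fun_on K \<Longrightarrow> \<omega> \<in> K \<Longrightarrow> Y \<omega> \<le> sup_expectation K Y"
  unfolding sup_expectation_def bounded_fun_on_def
  by (auto intro: cSUP_upper bounded_imp_bdd_above)

lemma sup_expectation_least:
  "K \<noteq> {} \<Longrightarrow> (\<And>\<omega>. \<omega> \<in> K \<Longrightarrow> Y \<omega> \<le> b) \<Longrightarrow> sup_expectation K Y \<le> b"
  unfolding sup_expectation_def by (rule cSUP_least)

text \<open>The value differs from the value at the origin by at most the Lipschitz constant times
  the Euclidean norm, which the sum of the coordinate bounds dominates.\<close>

lemma bounded_fun_on_Lip:
  assumes "\<And>i. i < m \<Longrightarrow> Z i \<in> bounded_fun_on K" "\<phi> \<in> C_Lip m"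
  shows "(\<lambda>\<omega>. \<phi> (tuple m Z \<omega>)) \<in> bounded_fun_on K"
proof -
  obtain C where C: "\<And>x y. x \<in> topspace (Euclidean_space m) \<Longrightarrow> y \<in> topspace (Euclidean_space m) \<Longrightarrow>
      \<bar>\<phi> x - \<phi> y\<bar> \<le> C * L2_set (\<lambda>i. x i - y i) {..<m}"
    using assms(2) unfolding C_Lip_def by blast
  have "\<forall>i. \<exists>B. i < m \<longrightarrow> (\<forall>\<omega>\<in>K. \<bar>Z i \<omega>\<bar> \<le> B)"
    using assms(1) by (metis bounded_fun_onE)
  then obtain B where B: "\<And>i \<omega>. i < m \<Longrightarrow> \<omega> \<in> K \<Longrightarrow> \<bar>Z i \<omega>\<bar> \<le> B i"
    by metis
  show ?thesis
  proof (rule bounded_fun_onI)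
    fix \<omega> assume \<omega>: "\<omega> \<in> K"
    have "L2_set (tuple m Z \<omega>) {..<m} \<le> (\<Sum>i<m. \<bar>tuple m Z \<omega> i\<bar>)"
      by (rule L2_set_le_sum_abs)
    also have "\<dots> \<le> (\<Sum>i<m. B i)"
      using B \<omega> by (intro sum_mono) (simp add: tuple_def)
    finally have "\<bar>C\<bar> * L2_set (tuple m Z \<omega>) {..<m} \<le> \<bar>C\<bar> * (\<Sum>i<m. B i)"
      by (simp add: mult_left_mono)
    \<comment> \<open>For \<open>m = 0\<close> the norm is always \<open>0\<close> and \<open>C\<close> may be negative, hence \<open>\<bar>C\<bar>\<close>.\<close>
    moreover have "C * L2_set (tuple m Z \<omega>) {..<m} \<le> \<bar>C\<bar> * L2_set (tuple m Z \<omega>) {..<m}"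
      by (simp add: mult_right_mono)
    moreover have "\<bar>\<phi> (tuple m Z \<omega>) - \<phi> (\<lambda>_. 0)\<bar> \<le> C * L2_set (tuple m Z \<omega>) {..<m}"
      using C[of "tuple m Z \<omega>" "\<lambda>_. 0"] tuple_topspace[of m Z \<omega>]
      by (simp add: topspace_Euclidean_space)
    ultimately show "\<bar>\<phi> (tuple m Z \<omega>)\<bar> \<le> \<bar>\<phi> (\<lambda>_. 0)\<bar> + \<bar>C\<bar> * (\<Sum>i<m. B i)"
      by linarith
  qed
qed

lemma sup_expectation_space:
  assumes "K \<noteq> {}"
  shows "sublinear_expectation_space K (bounded_fun_on K) (sup_expectation K)"
proof
  fix X Y :: "'a \<Rightarrow> real" and c l :: real
  show "X \<in> bounded_fun_on K" if "Y \<in> bounded_fun_on K" "\<And>\<omega>. \<omega> \<in> K \<Longrightarrow> X \<omega> = Y \<omega>"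
    using that by (metis bounded_fun_onE bounded_fun_onI)
  show "(\<lambda>\<omega>. X \<omega> + Y \<omega>) \<in> bounded_fun_on K" if "X \<in> bounded_fun_on K" "Y \<in> bounded_fun_on K"
    using that unfolding bounded_fun_on_def by (auto intro: bounded_plus_comp)
  show scale: "(\<lambda>\<omega>. c * X \<omega>) \<in> bounded_fun_on K" if "X \<in> bounded_fun_on K" for c
    using bounded_scaling[of "X ` K" c] that unfolding bounded_fun_on_def by (simp add: image_image)
  show "(\<lambda>\<omega>. c) \<in> bounded_fun_on K"
    by (rule bounded_fun_onI[of _ _ "\<bar>c\<bar>"]) simp
  show "(\<lambda>\<omega>. \<bar>X \<omega>\<bar>) \<in> bounded_fun_on K" if "X \<in> bounded_fun_on K"
    using that by (elim bounded_fun_onE, intro bounded_fun_onI) auto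
  show "sup_expectation K Y \<le> sup_expectation K X"
    if "X \<in> bounded_fun_on K" "Y \<in> bounded_fun_on K" "\<And>\<omega>. \<omega> \<in> K \<Longrightarrow> Y \<omega> \<le> X \<omega>"
    using that by (intro sup_expectation_least assms) (meson order_trans sup_expectation_upper)
  show "sup_expectation K (\<lambda>\<omega>. c) = c"
    using assms by (simp add: sup_expectation_def)
  show "sup_expectation K (\<lambda>\<omega>. X \<omega> + Y \<omega>) \<le> sup_expectation K X + sup_expectation K Y"
    if "X \<in> bounded_fun_on K" "Y \<in> bounded_fun_on K"
    using that by (intro sup_expectation_least assms add_mono sup_expectation_upper)
  show "sup_expectation K (\<lambda>\<omega>. l * X \<omega>) = l * sup_expectation K X"
    if X: "X \<in> bounded_fun_on K" and l: "0 \<le> l"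
  proof (cases "l = 0")
    case True
    then show ?thesis using assms by (simp add: sup_expectation_def)
  next
    case False
    with l have "0 < l" by simp
    \<comment> \<open>One inequality is the upper bound for \<open>l X\<close>; the other is that for \<open>X = (l X) / l\<close>.\<close>
    have "X \<omega> \<le> sup_expectation K (\<lambda>\<omega>. l * X \<omega>) / l" if "\<omega> \<in> K" for \<omega>
      using sup_expectation_upper[OF scale[OF X, of l] that] \<open>0 < l\<close> by (simp add: field_simps)
    then have "sup_expectation K X \<le> sup_expectation K (\<lambda>\<omega>. l * X \<omega>) / l"
      by (intro sup_expectation_least assms)
    moreover have "sup_expectation K (\<lambda>\<omega>. l * X \<omega>) \<le> l * sup_expectation K X"
      using X l by (intro sup_expectation_least assms mult_left_mono sup_expectation_upper)
    ultimately show ?thesis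
      using \<open>0 < l\<close> by (simp add: field_simps)
  qed
qed (rule bounded_fun_on_Lip)

text \<open>The law of a variable under the supremum depends only on its range. A variable with range
  \<open>{lo..hi}\<close> is therefore maximally distributed; compactness of the interval makes the
  supremum of a continuous test function a maximum, as \<open>is_maximum\<close> demands.\<close>

lemma is_maximum_sup_expectation:
  fixes \<phi> :: "real \<Rightarrow> real"
  assumes "continuous_on {lo..hi} \<phi>" "lo \<le> hi" "X ` K = {lo..hi}"
  shows "(\<lambda>\<omega>. \<phi> (X \<omega>)) \<in> bounded_fun_on K"
    and "is_maximum (\<phi> ` {lo..hi}) (sup_expectation K (\<lambda>\<omega>. \<phi> (X \<omega>)))"
proof -
  have im: "(\<lambda>\<omega>. \<phi> (X \<omega>)) ` K = \<phi> ` {lo..hi}"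
    using assms(3) by (metis image_image)
  have cpt: "compact (\<phi> ` {lo..hi})"
    using assms(1) by (intro compact_continuous_image compact_Icc)
  then show "(\<lambda>\<omega>. \<phi> (X \<omega>)) \<in> bounded_fun_on K"
    by (simp add: bounded_fun_on_def im compact_imp_bounded)
  have bdd: "bdd_above (\<phi> ` {lo..hi})"
    using cpt by (intro bounded_imp_bdd_above compact_imp_bounded)
  have "Sup (\<phi> ` {lo..hi}) \<in> \<phi> ` {lo..hi}"
    using cpt assms(2) bdd by (intro closed_contains_Sup compact_imp_closed) auto
  then show "is_maximum (\<phi> ` {lo..hi}) (sup_expectation K (\<lambda>\<omega>. \<phi> (X \<omega>)))"
    unfolding is_maximum_def sup_expectation_def im using bdd by (auto intro: cSup_upper)
qed

lemma C_lLip_continuous_on: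
  fixes \<phi> :: "real \<Rightarrow> real"
  assumes "\<phi> \<in> C_lLip"
  shows "continuous_on S \<phi>"
proof -
  obtain C k where C: "\<And>x y. \<bar>\<phi> x - \<phi> y\<bar> \<le> C * (1 + norm x ^ k + norm y ^ k) * norm (x - y)"
    using assms unfolding C_lLip_def by blast
  have "isCont \<phi> a" for a
  proof -
    have "((\<lambda>x. C * (1 + norm x ^ k + norm a ^ k) * norm (x - a)) \<longlongrightarrow>
        C * (1 + norm a ^ k + norm a ^ k) * norm (a - a)) (at a)"
      by (intro tendsto_intros)
    then have "((\<lambda>x. C * (1 + norm x ^ k + norm a ^ k) * norm (x - a)) \<longlongrightarrow> 0) (at a)"
      by simp
    then have "((\<lambda>x. \<phi> x - \<phi> a) \<longlongrightarrow> 0) (at a)"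
      by (rule Lim_null_comparison[rotated]) (simp add: C[simplified])
    then show ?thesis
      unfolding isCont_def by (simp add: LIM_zero_iff)
  qed
  then show ?thesis
    by (simp add: continuous_at_imp_continuous_on)
qed

section \<open>The canonical sample on a cube\<close>

definition cube :: "nat \<Rightarrow> real \<Rightarrow> real \<Rightarrow> (nat \<Rightarrow> real) set"
  where "cube n lo hi = {x \<in> topspace (Euclidean_space n). \<forall>i<n. x i \<in> {lo..hi}}"

lemma coordinate_image_cube:
  assumes "i < n" "lo \<le> hi"
  shows "(\<lambda>x. x i) ` cube n lo hi = {lo..hi}"
proof (intro equalityI subsetI)
  fix t assume "t \<in> {lo..hi}"
  then have "(\<lambda>j. if j < n then t else 0) \<in> cube n lo hi"
    by (auto simp: cube_def topspace_Euclidean_space)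
  then show "t \<in> (\<lambda>x. x i) ` cube n lo hi"
    using assms(1) by (intro image_eqI[of _ _ "\<lambda>j. if j < n then t else 0"]) auto
qed (use assms(1) in \<open>auto simp: cube_def\<close>)

text \<open>The coordinates from \<open>n\<close> on are fixed at \<open>0\<close>, so the cube is a product of compact sets
  indexed by all natural numbers, and Tychonoff's theorem applies.\<close>

lemma compactin_cube: "compactin (Euclidean_space n) (cube n lo hi)"
proof -
  have eq: "cube n lo hi = (\<Pi>\<^sub>E i\<in>UNIV. if i < n then {lo..hi} else {0})"
  proof (rule set_eqI)
    fix x :: "nat \<Rightarrow> real"
    show "x \<in> cube n lo hi \<longleftrightarrow> x \<in> (\<Pi>\<^sub>E i\<in>UNIV. if i < n then {lo..hi} else {0})"
      unfolding cube_def topspace_Euclidean_space PiE_UNIV_domain Pi_iff mem_Collect_eq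
      by (metis UNIV_I not_less singletonD singletonI)
  qed
  have "compactin (powertop_real UNIV) (cube n lo hi)"
    unfolding eq by (subst compactin_PiE) auto
  then show ?thesis
    by (auto simp: Euclidean_space_def compactin_subtopology cube_def topspace_Euclidean_space)
qed

lemma C_cont_bounded_on_cube:
  assumes "f \<in> C_cont n"
  shows "f \<in> bounded_fun_on (cube n lo hi)"
proof -
  have "compactin euclideanreal (f ` cube n lo hi)"
    using image_compactin[OF compactin_cube] assms unfolding C_cont_def by blast
  then show ?thesis
    by (simp add: bounded_fun_on_def compact_imp_bounded)
qed

text \<open>The cube is closed under replacing the \<open>i\<close>-th coordinate of one of its points by that of another.
  Hence a function of the earlier coordinates of \<open>x\<close> and the \<open>i\<close>-th coordinate of \<open>x'\<close> has the same
  supremum over all pairs \<open>(x, x')\<close> as over the diagonal, and the supremum over pairs is the iterated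
  one.\<close>

lemma independent_of_coordinate:
  assumes "i < n" "lo \<le> hi"
  defines "K \<equiv> cube n lo hi"
  shows "independent_of (bounded_fun_on K) (sup_expectation K) 1 (\<lambda>_ x. x i) i (\<lambda>j x. x j)"
  unfolding independent_of_def
proof (intro conjI allI impI ballI)
  have K: "K \<noteq> {}"
    using coordinate_image_cube[OF assms(1,2)] assms(2) by (auto simp: K_def)
  have coord: "(\<lambda>x. x j) \<in> bounded_fun_on K" if "j < n" for j
    using coordinate_image_cube[OF that assms(2)] by (simp add: bounded_fun_on_def K_def)
  show "(\<lambda>x. x i) \<in> bounded_fun_on K" and "\<And>j. j < i \<Longrightarrow> (\<lambda>x. x j) \<in> bounded_fun_on K"
    using coord assms(1) by auto
  fix \<phi> assume \<phi>: "\<phi> \<in> C_Lip (i + 1)"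
  define h where "h x x' = \<phi> (append_point i (tuple i (\<lambda>j x. x j) x) (tuple 1 (\<lambda>_ x. x i) x'))"
    for x x' :: "nat \<Rightarrow> real"
  have "append_point i (tuple i (\<lambda>j x. x j) x) (tuple 1 (\<lambda>_ x. x i) x) =
      tuple (i + 1) (\<lambda>j x. x j) x" for x
    by (rule ext) (auto simp: append_point_def tuple_def not_less less_Suc_eq)
  then have diag: "(\<lambda>x. h x x) \<in> bounded_fun_on K"
    unfolding h_def using bounded_fun_on_Lip[OF _ \<phi>, of "\<lambda>j x. x j" K] coord assms(1) by simp
  have splice: "x(i := x' i) \<in> K" "h (x(i := x' i)) (x(i := x' i)) = h x x'"
    if "x \<in> K" "x' \<in> K" for x x'
  proof -
    show "x(i := x' i) \<in> K"
      using that assms(1) by (auto simp: K_def cube_def topspace_Euclidean_space)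
    have "tuple i (\<lambda>j x. x j) (x(i := x' i)) = tuple i (\<lambda>j x. x j) x"
      "tuple 1 (\<lambda>_ x. x i) (x(i := x' i)) = tuple 1 (\<lambda>_ x. x i) x'"
      by (auto simp: tuple_def)
    then show "h (x(i := x' i)) (x(i := x' i)) = h x x'"
      by (simp add: h_def)
  qed
  have upper: "h x x' \<le> sup_expectation K (\<lambda>x. h x x)" if "x \<in> K" "x' \<in> K" for x x'
    using sup_expectation_upper[OF diag splice(1)[OF that]] splice(2)[OF that] by simp
  obtain B where B: "\<And>x. x \<in> K \<Longrightarrow> \<bar>h x x\<bar> \<le> B"
    using bounded_fun_onE[OF diag] by blast
  have section_bounded: "h x \<in> bounded_fun_on K" if "x \<in> K" for x
    by (rule bounded_fun_onI[of _ _ B]) (metis B splice that)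
  have inner_bounded: "(\<lambda>x. sup_expectation K (h x)) \<in> bounded_fun_on K"
  proof (rule bounded_fun_onI)
    fix x assume x: "x \<in> K"
    have "sup_expectation K (h x) \<le> B"
      using B splice x by (intro sup_expectation_least K) (metis abs_le_D1)
    moreover have "- B \<le> sup_expectation K (h x)"
      using sup_expectation_upper[OF section_bounded[OF x] x] B[OF x] by linarith
    ultimately show "\<bar>sup_expectation K (h x)\<bar> \<le> B" by simp
  qed
  have "sup_expectation K (\<lambda>x. h x x) = sup_expectation K (\<lambda>x. sup_expectation K (h x))"
  proof (rule antisym)
    show "sup_expectation K (\<lambda>x. h x x) \<le> sup_expectation K (\<lambda>x. sup_expectation K (h x))"
    proof (intro sup_expectation_least K)
      fix x assume x: "x \<in> K"
      have "h x x \<le> sup_expectation K (h x)"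
        by (rule sup_expectation_upper[OF section_bounded[OF x] x])
      also have "\<dots> \<le> sup_expectation K (\<lambda>x. sup_expectation K (h x))"
        by (rule sup_expectation_upper[OF inner_bounded x])
      finally show "h x x \<le> sup_expectation K (\<lambda>x. sup_expectation K (h x))" .
    qed
    show "sup_expectation K (\<lambda>x. sup_expectation K (h x)) \<le> sup_expectation K (\<lambda>x. h x x)"
      by (intro sup_expectation_least K upper)
  qed
  then show "sup_expectation K (\<lambda>\<omega>. \<phi> (append_point i (tuple i (\<lambda>j x. x j) \<omega>) (tuple 1 (\<lambda>_ x. x i) \<omega>))) =
    sup_expectation K (\<lambda>\<omega>. sup_expectation K
      (\<lambda>\<omega>'. \<phi> (append_point i (tuple i (\<lambda>j x. x j) \<omega>) (tuple 1 (\<lambda>_ x. x i) \<omega>'))))"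
    unfolding h_def .
qed

lemma canonical_sample:
  assumes "lo \<le> hi"
  shows "iid_maximal_sample (bounded_fun_on (cube n lo hi)) (sup_expectation (cube n lo hi))
    lo hi n (\<lambda>i x. x i)"
  unfolding iid_maximal_sample_def maximal_distribution_def
proof (intro conjI allI impI ballI)
  fix i assume i: "i < n"
  note max = is_maximum_sup_expectation[OF C_lLip_continuous_on assms coordinate_image_cube[OF i assms]]
  show "(\<lambda>x. x i) \<in> bounded_fun_on (cube n lo hi)"
    using coordinate_image_cube[OF i assms] by (simp add: bounded_fun_on_def)
  fix \<phi> :: "real \<Rightarrow> real" assume "\<phi> \<in> C_lLip"
  then show "(\<lambda>\<omega>. \<phi> (\<omega> i)) \<in> bounded_fun_on (cube n lo hi)"
    and "is_maximum (\<phi> ` {lo..hi}) (sup_expectation (cube n lo hi) (\<lambda>\<omega>. \<phi> (\<omega> i)))"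
    using max by auto
next
  fix i assume "i \<in> {1..<n}"
  then show "independent_of (bounded_fun_on (cube n lo hi)) (sup_expectation (cube n lo hi))
      1 (\<lambda>_ x. x i) i (\<lambda>j x. x j)"
    using assms by (intro independent_of_coordinate) auto
qed

lemma tuple_coordinates_cube: "x \<in> cube n lo hi \<Longrightarrow> tuple n (\<lambda>i x. x i) x = x"
  by (auto simp: tuple_def cube_def topspace_Euclidean_space)

lemma point_in_cube:
  assumes "y \<in> topspace (Euclidean_space n)"
  shows "y \<in> cube n (min_stat n y) (max_stat n y)"
  using assms by (auto simp: cube_def min_stat_def max_stat_def)

section \<open>Extremality\<close>

lemma canonical_statistic_in_space:
  assumes "f \<in> C_cont n"
  shows "(\<lambda>x. f (tuple n (\<lambda>i x. x i) x)) \<in> bounded_fun_on (cube n lo hi)"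
proof -
  obtain B where "\<And>x. x \<in> cube n lo hi \<Longrightarrow> \<bar>f x\<bar> \<le> B"
    using bounded_fun_onE[OF C_cont_bounded_on_cube[OF assms]] by blast
  then show ?thesis
    by (intro bounded_fun_onI[of _ _ B]) (simp add: tuple_coordinates_cube)
qed

text \<open>Unbiasedness is tested on the smallest cube \<open>{lo..hi}\<^sup>n\<close> containing \<open>y\<close>, since there the upper
  mean \<open>hi\<close> equals the bound that is wanted.\<close>

lemma unbiased_upper_mean_le_max:
  assumes "1 \<le> n" "unbiased_upper_mean TYPE(nat \<Rightarrow> real) n f" "y \<in> topspace (Euclidean_space n)"
  shows "f y \<le> max_stat n y"
proof -
  let ?K = "cube n (min_stat n y) (max_stat n y)"
  let ?f = "\<lambda>x. f (tuple n (\<lambda>i x. x i) x)"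
  note y = point_in_cube[OF assms(3)] and le = min_stat_le_max_stat[OF assms(1), of y]
  have nonempty: "?K \<noteq> {}"
    using y by blast
  have f: "?f \<in> bounded_fun_on ?K"
    using assms(2) by (intro canonical_statistic_in_space) (simp add: unbiased_upper_mean_def)
  have "f y \<le> sup_expectation ?K ?f"
    using sup_expectation_upper[OF f y] by (simp add: tuple_coordinates_cube[OF y])
  also have "\<dots> = max_stat n y"
    using assms(2)[unfolded unbiased_upper_mean_def, THEN conjunct2, rule_format,
      OF le sup_expectation_space[OF nonempty] canonical_sample[OF le] f] .
  finally show ?thesis .
qed

lemma unbiased_lower_mean_ge_min:
  assumes "1 \<le> n" "unbiased_lower_mean TYPE(nat \<Rightarrow> real) n f" "y \<in> topspace (Euclidean_space n)"
  shows "min_stat n y \<le> f y"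
proof -
  let ?K = "cube n (min_stat n y) (max_stat n y)"
  let ?f = "\<lambda>x. f (tuple n (\<lambda>i x. x i) x)"
  note y = point_in_cube[OF assms(3)] and le = min_stat_le_max_stat[OF assms(1), of y]
  have nonempty: "?K \<noteq> {}"
    using y by blast
  have f: "?f \<in> bounded_fun_on ?K"
    using assms(2) by (intro canonical_statistic_in_space) (simp add: unbiased_lower_mean_def)
  then have nf: "(\<lambda>x. - ?f x) \<in> bounded_fun_on ?K"
    by (elim bounded_fun_onE, intro bounded_fun_onI) auto
  have "min_stat n y = - sup_expectation ?K (\<lambda>x. - ?f x)"
    using assms(2)[unfolded unbiased_lower_mean_def, THEN conjunct2, rule_format,
      OF le sup_expectation_space[OF nonempty] canonical_sample[OF le] f] by (rule sym)
  also have "\<dots> \<le> f y"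
    using sup_expectation_upper[OF nf y] by (simp add: tuple_coordinates_cube[OF y])
  finally show ?thesis .
qed

section \<open>The extreme order statistics as estimators\<close>

lemma continuous_map_coordinate: "continuous_map (Euclidean_space n) euclideanreal (\<lambda>x. x i)"
  unfolding Euclidean_space_def
  by (intro continuous_map_from_subtopology continuous_map_product_projection) simp

lemma extreme_stats_C_cont:
  assumes "1 \<le> n"
  shows "max_stat n \<in> C_cont n" "min_stat n \<in> C_cont n"
proof -
  have "continuous_map T euclideanreal (\<lambda>x. Max ((\<lambda>i. x i) ` I)) \<and>
      continuous_map T euclideanreal (\<lambda>x. Min ((\<lambda>i. x i) ` I))"
    if "finite I" "I \<noteq> {}" "\<And>i. continuous_map T euclideanreal (\<lambda>x. x i)"
    for I :: "nat set" and T :: "(nat \<Rightarrow> real) topology"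
    using that(1,2)
  proof (induction I rule: finite_ne_induct)
    case (singleton i)
    then show ?case using that(3) by simp
  next
    case (insert i I)
    then show ?case using that(3)
      by (auto intro!: continuous_map_real_max continuous_map_real_min)
  qed
  from this[of "{..<n}" "Euclidean_space n"] assms
  show "max_stat n \<in> C_cont n" "min_stat n \<in> C_cont n"
    unfolding C_cont_def max_stat_def min_stat_def
    by (auto simp: continuous_map_coordinate lessThan_empty_iff)
qed

lemma max_stat_unbiased: "1 \<le> n \<Longrightarrow> unbiased_upper_mean TYPE('a) n (max_stat n)"
  unfolding unbiased_upper_mean_def iid_maximal_sample_def
  by (auto simp: extreme_stats_C_cont intro: sublinear_expectation_space.expectation_max_sample)

lemma min_stat_unbiased: "1 \<le> n \<Longrightarrow> unbiased_lower_mean TYPE('a) n (min_stat n)"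
  unfolding unbiased_lower_mean_def iid_maximal_sample_def
  by (simp add: extreme_stats_C_cont sublinear_expectation_space.expectation_min_sample)

lemma sample_quasi_surely_bounds:
  assumes "1 \<le> n" "lo \<le> hi" "iid_maximal_sample \<H> \<E> lo hi n X" "represents \<Omega> \<H> \<E> \<Theta> P"
  shows "quasi_surely \<Theta> P (\<lambda>\<omega>. lo \<le> min_stat n (tuple n X \<omega>) \<and>
    min_stat n (tuple n X \<omega>) \<le> max_stat n (tuple n X \<omega>) \<and> max_stat n (tuple n X \<omega>) \<le> hi)"
  unfolding quasi_surely_def
proof
  fix \<theta> assume "\<theta> \<in> \<Theta>"
  then have "AE \<omega> in P \<theta>. \<forall>i\<in>{..<n}. lo \<le> X i \<omega> \<and> X i \<omega> \<le> hi"
    using maximal_distribution_quasi_surely[OF _ assms(2,4)] assms(3)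
    by (intro AE_finite_allI) (auto simp: iid_maximal_sample_def quasi_surely_def)
  then show "AE \<omega> in P \<theta>. lo \<le> min_stat n (tuple n X \<omega>) \<and>
    min_stat n (tuple n X \<omega>) \<le> max_stat n (tuple n X \<omega>) \<and> max_stat n (tuple n X \<omega>) \<le> hi"
  proof eventually_elim
    case (elim \<omega>)
    then show ?case
      using assms(1) min_stat_le_max_stat[OF assms(1)]
      by (auto simp: min_stat_tuple max_stat_tuple lessThan_empty_iff)
  qed
qed

theorem theorem24:
  fixes n :: nat
  assumes "1 \<le> n"
  shows
    "(\<forall>(\<Omega> :: 'a set) \<H> \<E> lo hi X (\<Theta> :: 't set) P.
        sublinear_expectation_space \<Omega> \<H> \<E> \<longrightarrow> lo \<le> hi \<longrightarrow>
        iid_maximal_sample \<H> \<E> lo hi n X \<longrightarrow> represents \<Omega> \<H> \<E> \<Theta> P \<longrightarrow>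
        quasi_surely \<Theta> P (\<lambda>\<omega>. lo \<le> min_stat n (tuple n X \<omega>) \<and>
          min_stat n (tuple n X \<omega>) \<le> max_stat n (tuple n X \<omega>) \<and>
          max_stat n (tuple n X \<omega>) \<le> hi)) \<and>
     (unbiased_upper_mean TYPE('a) n (max_stat n) \<and>
      (\<forall>f. unbiased_upper_mean TYPE(nat \<Rightarrow> real) n f \<longrightarrow>
        (\<forall>y \<in> topspace (Euclidean_space n). f y \<le> max_stat n y))) \<and>
     (unbiased_lower_mean TYPE('a) n (min_stat n) \<and>
      (\<forall>f. unbiased_lower_mean TYPE(nat \<Rightarrow> real) n f \<longrightarrow>
        (\<forall>y \<in> topspace (Euclidean_space n). min_stat n y \<le> f y)))"
  using sample_quasi_surely_bounds[OF assms]
    max_stat_unbiased[OF assms] unbiased_upper_mean_le_max[OF assms]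
    min_stat_unbiased[OF assms] unbiased_lower_mean_ge_min[OF assms]
  by auto

end
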